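(* If $P$ is a default-enabled poset, then $\langle P,\mathrm{clsys}_P\rangle$ and $\langle P,\mathrm{dcclsys}_P\rangle$ are convex geometries.
   Context: A poset has a ceiling if each of its elements is below some maximal element of it; a subset of a poset has a ceiling if it does so as a subposet. A poset $P$ is default-enabled if for every subset $X\subseteq P$ (including $X=\emptyset$) the set of all lower bounds of $X$ in $P$ has a ceiling. A closure operator on a poset is an increasing, ascending ($x\le\gamma(x)$), idempotent map from the poset to itself. A closure system in a poset $P$ is the fixpoint set of a closure operator on $P$; equivalently, a subset $C\subseteq P$ such that for every $x\in P$ the set $\{y\in C: y\ge x\}$ has a least element. A subset $A$ of $P$ is closed under existing directed joins if, whenever a directed subset of $A$ has a join in $P$, this join belongs to $A$. For a default-enabled poset $P$, the intersection of any set of closure systems in $P$ is a closure system in $P$, and likewise for closure systems closed under existing directed joins. For $X\subseteq P$, $\mathrm{clsys}_P(X)$ is the least closure system in $P$ including $X$, and $\mathrm{dcclsys}_P(X)$ is the least closure system in $P$ that is closed under existing directed joins in $P$ and includes $X$; both are closure operators on the powerset lattice $\mathcal{P}(P)$. A convex geometry is a pair $\langle E,\gamma\rangle$ where $E$ is a set and $\gamma$ is a closure operator on $\mathcal{P}(E)$ that is convex, i.e. satisfies the anti-exchange axiom: for every $A\subseteq E$ and all $x,y\in E$, if $x,y\notin\gamma(A)$, $x\ne y$ and $x\in\gamma(A\cup\{y\})$, then $y\notin\gamma(A\cup\{x\})$. (It is not required that $\gamma(\emptyset)=\emptyset$.) *)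

theory Defs
  imports "HOL-Algebra.Complete_Lattice"
begin

text \<open>Posets are records \<open>P\<close> of HOL-Algebra satisfying \<^locale>\<open>partial_order\<close>; the underlying set is
  \<^term>\<open>carrier P\<close>, which may be empty.\<close>

definition maximal_in :: "('a, 'c) gorder_scheme \<Rightarrow> 'a \<Rightarrow> 'a set \<Rightarrow> bool" where
  "maximal_in P m A \<longleftrightarrow> m \<in> A \<and> (\<forall>x\<in>A. m \<sqsubseteq>\<^bsub>P\<^esub> x \<longrightarrow> x = m)"

definition has_ceiling :: "('a, 'c) gorder_scheme \<Rightarrow> 'a set \<Rightarrow> bool" where
  "has_ceiling P A \<longleftrightarrow> (\<forall>x\<in>A. \<exists>m. maximal_in P m A \<and> x \<sqsubseteq>\<^bsub>P\<^esub> m)"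

definition default_enabled :: "('a, 'c) gorder_scheme \<Rightarrow> bool" where
  "default_enabled P \<longleftrightarrow> (\<forall>X\<subseteq>carrier P. has_ceiling P (Lower P X))"

definition closure_operator :: "('a, 'c) gorder_scheme \<Rightarrow> ('a \<Rightarrow> 'a) \<Rightarrow> bool" where
  "closure_operator P \<gamma> \<longleftrightarrow>
     \<gamma> \<in> carrier P \<rightarrow> carrier P \<and> isotone P P \<gamma> \<and>
     (\<forall>x\<in>carrier P. x \<sqsubseteq>\<^bsub>P\<^esub> \<gamma> x) \<and> idempotent P \<gamma>"

definition closure_system :: "('a, 'c) gorder_scheme \<Rightarrow> 'a set \<Rightarrow> bool" where
  "closure_system P C \<longleftrightarrow> (\<exists>\<gamma>. closure_operator P \<gamma> \<and> C = fps P \<gamma>)"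

text \<open>Directed sets are nonempty, as usual; so closure under existing directed joins does not force
  the least element of \<open>P\<close>, if there is one, to be a member.\<close>

definition directed_in :: "('a, 'c) gorder_scheme \<Rightarrow> 'a set \<Rightarrow> bool" where
  "directed_in P D \<longleftrightarrow>
     D \<subseteq> carrier P \<and> D \<noteq> {} \<and> (\<forall>x\<in>D. \<forall>y\<in>D. \<exists>z\<in>D. x \<sqsubseteq>\<^bsub>P\<^esub> z \<and> y \<sqsubseteq>\<^bsub>P\<^esub> z)"

definition closed_directed_joins :: "('a, 'c) gorder_scheme \<Rightarrow> 'a set \<Rightarrow> bool" where
  "closed_directed_joins P A \<longleftrightarrow>
     (\<forall>D s. D \<subseteq> A \<longrightarrow> directed_in P D \<longrightarrow> is_lub P s D \<longrightarrow> s \<in> A)"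

definition powerset_lattice :: "'a set \<Rightarrow> 'a set gorder" where
  "powerset_lattice E = \<lparr>carrier = Pow E, eq = (=), le = (\<subseteq>)\<rparr>"

text \<open>The least element need not exist for an arbitrary poset; it does when \<open>P\<close> is
  default-enabled. Otherwise the description below is unspecified.\<close>

definition clsys :: "('a, 'c) gorder_scheme \<Rightarrow> 'a set \<Rightarrow> 'a set" where
  "clsys P X = (THE C. least (powerset_lattice (carrier P)) C {C. closure_system P C \<and> X \<subseteq> C})"

definition dcclsys :: "('a, 'c) gorder_scheme \<Rightarrow> 'a set \<Rightarrow> 'a set" where
  "dcclsys P X = (THE C. least (powerset_lattice (carrier P)) C
     {C. closure_system P C \<and> closed_directed_joins P C \<and> X \<subseteq> C})"

definition convex_geometry :: "'a set \<Rightarrow> ('a set \<Rightarrow> 'a set) \<Rightarrow> bool" where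
  "convex_geometry E \<gamma> \<longleftrightarrow>
     closure_operator (powerset_lattice E) \<gamma> \<and>
     (\<forall>A\<subseteq>E. \<forall>x\<in>E. \<forall>y\<in>E.
        x \<notin> \<gamma> A \<longrightarrow> y \<notin> \<gamma> A \<longrightarrow> x \<noteq> y \<longrightarrow> x \<in> \<gamma> (A \<union> {y}) \<longrightarrow> y \<notin> \<gamma> (A \<union> {x}))"

end

theory Submission
  imports Defs
begin

text \<open>Let \<open>C\<close> be a closure system and \<open>y\<close> a point. Then \<open>C \<union> {z. z \<le> y}\<close> is again a closure
  system: a point not below \<open>y\<close> has exactly the same members above it as in \<open>C\<close>, every other
  point is itself a member. It inherits closure under directed joins from \<open>C\<close>. Hence
  \<open>x\<close> belongs to the closure of \<open>A \<union> {y}\<close> without belonging to that of \<open>A\<close> only if \<open>x \<le> y\<close>, and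
  anti-exchange is antisymmetry. Default-enabledness serves only to make intersections
  of closure systems closure systems.\<close>

section \<open>Convex geometries from families of sets\<close>

lemma closure_operator_powersetI:
  assumes "\<And>X. X \<subseteq> E \<Longrightarrow> \<gamma> X \<subseteq> E"
    and "\<And>X. X \<subseteq> E \<Longrightarrow> X \<subseteq> \<gamma> X"
    and "\<And>X Y. X \<subseteq> Y \<Longrightarrow> Y \<subseteq> E \<Longrightarrow> \<gamma> X \<subseteq> \<gamma> Y"
    and "\<And>X. X \<subseteq> E \<Longrightarrow> \<gamma> (\<gamma> X) = \<gamma> X"
  shows "closure_operator (powerset_lattice E) \<gamma>"
proof -
  \<comment> \<open>\<open>isotone\<close> includes the demand that both of its orders be weak
    partial orders.\<close>
  have "weak_partial_order (powerset_lattice E)"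
    by unfold_locales (auto simp: powerset_lattice_def)
  then show ?thesis
    using assms unfolding closure_operator_def isotone_def idempotent_def
    by (auto simp: powerset_lattice_def)
qed

text \<open>\<open>Q\<close> stands for being closed, so that \<open>clsys\<close> and
  \<open>dcclsys\<close> are both instances. Meeting with \<open>E\<close> lets the empty family
  yield \<open>E\<close>. Anti-exchange only forbids that each of two points lies in the closure
  generated with the other, so \<open>sep\<close> may pick which of them \<open>K\<close>
  contains.\<close>

lemma convex_geometryI:
  assumes sub: "\<And>C. Q C \<Longrightarrow> C \<subseteq> E"
    and Int: "\<And>F. (\<And>C. C \<in> F \<Longrightarrow> Q C) \<Longrightarrow> Q (E \<inter> \<Inter>F)"
    and sep: "\<And>C x y. \<lbrakk>Q C; x \<in> E - C; y \<in> E - C; x \<noteq> y\<rbrakk> \<Longrightarrow>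
      \<exists>K. Q K \<and> C \<subseteq> K \<and> (y \<in> K \<and> x \<notin> K \<or> x \<in> K \<and> y \<notin> K)"
  shows "convex_geometry E (\<lambda>X. THE C. least (powerset_lattice E) C {C. Q C \<and> X \<subseteq> C})"
proof -
  define \<gamma> where "\<gamma> = (\<lambda>X. THE C. least (powerset_lattice E) C {C. Q C \<and> X \<subseteq> C})"
  \<comment> \<open>If \<open>X\<close> is not within \<open>E\<close>, no \<open>C\<close> with
    \<open>Q C\<close> includes it and the description has no witness.\<close>
  have \<gamma>: "\<gamma> X = E \<inter> \<Inter>{C. Q C \<and> X \<subseteq> C}" if "X \<subseteq> E" for X
    unfolding \<gamma>_def
  proof (rule the_equality)
    have "Q (E \<inter> \<Inter>{C. Q C \<and> X \<subseteq> C})"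
      by (rule Int) simp
    with that sub show "least (powerset_lattice E) (E \<inter> \<Inter>{C. Q C \<and> X \<subseteq> C}) {C. Q C \<and> X \<subseteq> C}"
      by (auto simp: least_def powerset_lattice_def)
    show "C = E \<inter> \<Inter>{C. Q C \<and> X \<subseteq> C}"
      if "least (powerset_lattice E) C {C. Q C \<and> X \<subseteq> C}" for C
    proof -
      have "Q C" "X \<subseteq> C" "\<And>K. Q K \<Longrightarrow> X \<subseteq> K \<Longrightarrow> C \<subseteq> K"
        using that by (simp_all add: least_def powerset_lattice_def)
      then show ?thesis
        using sub[of C] by blast
    qed
  qed
  have Q: "Q (\<gamma> X)" if "X \<subseteq> E" for X
    unfolding \<gamma>[OF that] by (rule Int) simp
  have le: "X \<subseteq> \<gamma> X" if "X \<subseteq> E" for X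
    using \<gamma>[OF that] that by auto
  have least: "\<gamma> X \<subseteq> K" if "Q K" "X \<subseteq> K" for X K
    using \<gamma>[of X] sub[of K] that by auto
  have "closure_operator (powerset_lattice E) \<gamma>"
  proof (rule closure_operator_powersetI)
    show "\<gamma> X \<subseteq> E" if "X \<subseteq> E" for X
      using Q[OF that] sub by blast
    show "\<gamma> X \<subseteq> \<gamma> Y" if "X \<subseteq> Y" "Y \<subseteq> E" for X Y
      using Q[OF that(2)] le[OF that(2)] that(1) by (intro least) auto
    show "\<gamma> (\<gamma> X) = \<gamma> X" if "X \<subseteq> E" for X
      using Q[OF that] sub le least by (meson equalityI order_refl)
  qed (rule le)
  moreover have "y \<notin> \<gamma> (A \<union> {x})"
    if A: "A \<subseteq> E"
      and xy: "x \<in> E" "y \<in> E" "x \<notin> \<gamma> A" "y \<notin> \<gamma> A" "x \<noteq> y" "x \<in> \<gamma> (A \<union> {y})" for A x y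
  proof -
    obtain K where K: "Q K" "\<gamma> A \<subseteq> K" "y \<in> K \<and> x \<notin> K \<or> x \<in> K \<and> y \<notin> K"
      using sep[OF Q[OF A], of x y] xy by blast
    \<comment> \<open>With \<open>z = y\<close> the first alternative for \<open>K\<close>
      contradicts \<open>x \<in> \<gamma> (A \<union> {y})\<close>; with \<open>z = x\<close> the
      second one is the goal.\<close>
    have "z \<in> K \<Longrightarrow> \<gamma> (A \<union> {z}) \<subseteq> K" for z
      using K le[OF A] by (intro least) auto
    with K(3) xy show ?thesis by blast
  qed
  ultimately show ?thesis
    unfolding convex_geometry_def \<gamma>_def[symmetric] by blast
qed

section \<open>Closure systems in a poset\<close>

context partial_order
begin

text \<open>A closure operator sends \<open>x\<close> to the least of its fixpoints above
  \<open>x\<close>; choosing these least elements therefore recovers the operator from its fixpoint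
  set.\<close>

lemma closure_system_iff:
  "closure_system L C \<longleftrightarrow> C \<subseteq> carrier L \<and> (\<forall>x\<in>carrier L. \<exists>l. least L l {y \<in> C. x \<sqsubseteq> y})"
proof (intro iffI conjI ballI)
  assume "closure_system L C"
  then obtain \<gamma> where \<gamma>: "closure_operator L \<gamma>" and C: "C = fps L \<gamma>"
    unfolding closure_system_def by blast
  show "C \<subseteq> carrier L"
    unfolding C fps_def by blast
  fix x assume x: "x \<in> carrier L"
  \<comment> \<open>Isotony gives \<open>\<gamma> x \<sqsubseteq> \<gamma> y = y\<close>.\<close>
  have "\<gamma> x \<sqsubseteq> y" if "y \<in> carrier L" "\<gamma> y = y" "x \<sqsubseteq> y" for y
    using \<gamma> x that unfolding closure_operator_def isotone_def by metis
  then have "least L (\<gamma> x) {y \<in> C. x \<sqsubseteq> y}"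
    using \<gamma> x unfolding C closure_operator_def least_def fps_def idempotent_def
    by (auto simp: eq_is_equal)
  then show "\<exists>l. least L l {y \<in> C. x \<sqsubseteq> y}" ..
next
  assume *: "C \<subseteq> carrier L \<and> (\<forall>x\<in>carrier L. \<exists>l. least L l {y \<in> C. x \<sqsubseteq> y})"
  then have C: "C \<subseteq> carrier L" by blast
  from * obtain \<gamma> where "\<And>x. x \<in> carrier L \<Longrightarrow> least L (\<gamma> x) {y \<in> C. x \<sqsubseteq> y}"
    by metis
  then have mem: "\<gamma> x \<in> C" and ge: "x \<sqsubseteq> \<gamma> x"
    and min: "\<And>y. y \<in> C \<Longrightarrow> x \<sqsubseteq> y \<Longrightarrow> \<gamma> x \<sqsubseteq> y" if "x \<in> carrier L" for x
    using that unfolding least_def by blast+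
  have fixed: "\<gamma> x = x" if "x \<in> C" for x
    using that C mem ge min by (meson le_antisym le_refl subsetD)
  have "isotone L L \<gamma>"
  proof (rule isotoneI)
    show "\<gamma> x \<sqsubseteq> \<gamma> y" if "x \<in> carrier L" "y \<in> carrier L" "x \<sqsubseteq> y" for x y
      using that mem ge C by (meson min le_trans subsetD)
  qed unfold_locales
  then have "closure_operator L \<gamma>"
    using mem ge fixed C unfolding closure_operator_def idempotent_def
    by (auto simp: eq_is_equal)
  moreover have "C = fps L \<gamma>"
  proof (intro equalityI subsetI)
    show "x \<in> C" if "x \<in> fps L \<gamma>" for x
      using that mem[of x] unfolding fps_def by (simp add: eq_is_equal)
  qed (use fixed C in \<open>auto simp: fps_def eq_is_equal\<close>)
  ultimately show "closure_system L C"
    unfolding closure_system_def by blast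
qed

text \<open>The least member above \<open>x\<close> is found from below: it is a maximal lower
  bound, above \<open>x\<close>, of the set of all members above \<open>x\<close>. Maximality forces
  this bound into each of the given systems.\<close>

lemma closure_system_Inter:
  assumes "default_enabled L" and F: "\<And>C. C \<in> F \<Longrightarrow> closure_system L C"
  shows "closure_system L (carrier L \<inter> \<Inter>F)"
  unfolding closure_system_iff
proof (intro conjI ballI)
  fix x assume x: "x \<in> carrier L"
  let ?U = "{y \<in> carrier L \<inter> \<Inter>F. x \<sqsubseteq> y}"
  have "x \<in> Lower L ?U"
    using x by (auto simp: Lower_def)
  \<comment> \<open>\<open>?U\<close> is not yet known to be nonempty, so default-enabledness is
    also needed for the empty set.\<close>
  moreover have "has_ceiling L (Lower L ?U)"
    using assms(1) unfolding default_enabled_def by (elim allE[of _ ?U]) auto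
  ultimately obtain m where m: "maximal_in L m (Lower L ?U)" "x \<sqsubseteq> m"
    unfolding has_ceiling_def by blast
  from m(1) have max: "\<And>l. l \<in> Lower L ?U \<Longrightarrow> m \<sqsubseteq> l \<Longrightarrow> l = m"
    and "m \<in> Lower L ?U"
    by (simp_all add: maximal_in_def)
  then have m': "m \<in> carrier L" "\<And>y. y \<in> ?U \<Longrightarrow> m \<sqsubseteq> y"
    by (simp_all add: Lower_def)
  \<comment> \<open>The least member \<open>l\<close> of \<open>C\<close> above \<open>m\<close> is
    again a lower bound of \<open>?U\<close>, since \<open>?U\<close> consists of members of
    \<open>C\<close> above \<open>m\<close>. By maximality \<open>l = m\<close>.\<close>
  have "m \<in> C" if "C \<in> F" for C
  proof -
    obtain l where l: "least L l {y \<in> C. m \<sqsubseteq> y}"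
      using F[OF \<open>C \<in> F\<close>] m'(1) unfolding closure_system_iff by blast
    then have "l \<in> Lower L ?U"
      using m'(2) \<open>C \<in> F\<close> unfolding least_def Lower_def by blast
    with l max show ?thesis
      unfolding least_def by blast
  qed
  with m' m(2) have "least L m ?U"
    unfolding least_def by blast
  then show "\<exists>l. least L l ?U" ..
qed simp

lemma closure_system_Un_down:
  assumes C: "closure_system L C" and y: "y \<in> carrier L"
  shows "closure_system L (C \<union> {z \<in> carrier L. z \<sqsubseteq> y})"
  unfolding closure_system_iff
proof (intro conjI ballI)
  show "C \<union> {z \<in> carrier L. z \<sqsubseteq> y} \<subseteq> carrier L"
    using C unfolding closure_system_iff by blast
  then have sub: "C \<subseteq> carrier L" by blast
  fix x assume x: "x \<in> carrier L"
  show "\<exists>l. least L l {z \<in> C \<union> {z \<in> carrier L. z \<sqsubseteq> y}. x \<sqsubseteq> z}"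
  proof (cases "x \<sqsubseteq> y")
    case True
    then have "least L x {z \<in> C \<union> {z \<in> carrier L. z \<sqsubseteq> y}. x \<sqsubseteq> z}"
      using x sub unfolding least_def by auto
    then show ?thesis ..
  next
    case False
    \<comment> \<open>A point between \<open>x\<close> and \<open>y\<close> would put
      \<open>x\<close> below \<open>y\<close>.\<close>
    then have "{z \<in> C \<union> {z \<in> carrier L. z \<sqsubseteq> y}. x \<sqsubseteq> z} = {z \<in> C. x \<sqsubseteq> z}"
      using x y le_trans by blast
    then show ?thesis
      using C x unfolding closure_system_iff by simp
  qed
qed

section \<open>Closure under directed joins\<close>

lemma closed_directed_joins_Inter:
  assumes "\<And>C. C \<in> F \<Longrightarrow> closed_directed_joins L C"
  shows "closed_directed_joins L (carrier L \<inter> \<Inter>F)"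
  unfolding closed_directed_joins_def
proof (intro allI impI IntI InterI)
  fix D s
  assume D: "D \<subseteq> carrier L \<inter> \<Inter>F" "directed_in L D" and s: "is_lub L s D"
  then show "s \<in> carrier L"
    by (simp add: least_def Upper_def)
  show "s \<in> C" if "C \<in> F" for C
    using assms[OF that] D s that unfolding closed_directed_joins_def
    by (meson Inter_lower le_inf_iff order_trans)
qed

text \<open>Either \<open>y\<close> bounds the directed set and hence its join, or some tail of the
  set avoids the down-set of \<open>y\<close> and has the same join.\<close>

lemma closed_directed_joins_Un_down:
  assumes C: "closed_directed_joins L C" and y: "y \<in> carrier L"
  shows "closed_directed_joins L (C \<union> {z \<in> carrier L. z \<sqsubseteq> y})"
  unfolding closed_directed_joins_def
proof (intro allI impI)
  fix D s
  assume D: "D \<subseteq> C \<union> {z \<in> carrier L. z \<sqsubseteq> y}" "directed_in L D" and s: "is_lub L s D"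
  have DL: "D \<subseteq> carrier L"
    using D(2) unfolding directed_in_def by blast
  have dir: "\<exists>z\<in>D. a \<sqsubseteq> z \<and> b \<sqsubseteq> z" if "a \<in> D" "b \<in> D" for a b
    using D(2) that unfolding directed_in_def by simp
  have sL: "s \<in> carrier L" and ub: "\<And>d. d \<in> D \<Longrightarrow> d \<sqsubseteq> s"
    and lub: "\<And>u. u \<in> carrier L \<Longrightarrow> (\<And>d. d \<in> D \<Longrightarrow> d \<sqsubseteq> u) \<Longrightarrow> s \<sqsubseteq> u"
    using s DL unfolding least_def Upper_def by auto
  show "s \<in> C \<union> {z \<in> carrier L. z \<sqsubseteq> y}"
  proof (cases "\<forall>d\<in>D. d \<sqsubseteq> y")
    case True
    then show ?thesis
      using lub y sL by blast
  next
    case False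
    then obtain d where d: "d \<in> D" "\<not> d \<sqsubseteq> y" by blast
    text \<open>The part of \<open>D\<close> above \<open>d\<close> is cofinal in \<open>D\<close> and lies in \<open>C\<close>.\<close>
    define D' where "D' = {e \<in> D. d \<sqsubseteq> e}"
    \<comment> \<open>The form with two points yields cofinality, directedness of \<open>D'\<close>
      and, for \<open>a = b = d\<close>, its nonemptiness.\<close>
    have cofinal: "\<exists>z\<in>D'. a \<sqsubseteq> z \<and> b \<sqsubseteq> z" if "a \<in> D" "b \<in> D" for a b
    proof -
      obtain u where u: "u \<in> D" "a \<sqsubseteq> u" "b \<sqsubseteq> u"
        using dir \<open>a \<in> D\<close> \<open>b \<in> D\<close> by metis
      obtain v where v: "v \<in> D" "u \<sqsubseteq> v" "d \<sqsubseteq> v"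
        using dir u(1) d(1) by metis
      show ?thesis
        using u v that DL le_trans[of a u v] le_trans[of b u v] unfolding D'_def by blast
    qed
    \<comment> \<open>An element of \<open>D'\<close> below \<open>y\<close> would put
      \<open>d\<close> below \<open>y\<close>.\<close>
    have "D' \<subseteq> C"
      using D(1) d DL y le_trans[of d _ y] unfolding D'_def by blast
    moreover have "directed_in L D'"
      using cofinal cofinal[OF d(1) d(1)] DL unfolding directed_in_def by (auto simp: D'_def)
    moreover have "is_lub L s D'"
    proof -
      have "s \<sqsubseteq> u" if u: "u \<in> carrier L" "\<And>e. e \<in> D' \<Longrightarrow> e \<sqsubseteq> u" for u
      proof (rule lub)
        fix a assume a: "a \<in> D"
        then obtain z where "z \<in> D'" "a \<sqsubseteq> z"
          using cofinal by blast
        then show "a \<sqsubseteq> u"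
          using u a DL le_trans[of a z u] unfolding D'_def by blast
      qed (rule u)
      then show ?thesis
        using sL ub DL unfolding least_def Upper_def by (auto simp: D'_def subset_iff)
    qed
    ultimately show ?thesis
      using C unfolding closed_directed_joins_def by blast
  qed
qed

section \<open>Separation of points and the two geometries\<close>

text \<open>If \<open>x \<sqsubseteq> y\<close>, the down-set of \<open>x\<close> misses
  \<open>y\<close> by antisymmetry; otherwise the down-set of \<open>y\<close> misses
  \<open>x\<close>.\<close>

lemma down_separates:
  assumes "\<And>y. y \<in> carrier L \<Longrightarrow> Q (C \<union> {z \<in> carrier L. z \<sqsubseteq> y})"
    and "x \<in> carrier L - C" "y \<in> carrier L - C" "x \<noteq> y"
  shows "\<exists>K. Q K \<and> C \<subseteq> K \<and> (y \<in> K \<and> x \<notin> K \<or> x \<in> K \<and> y \<notin> K)"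
proof (cases "x \<sqsubseteq> y")
  case True
  with assms have "\<not> y \<sqsubseteq> x"
    using le_antisym by blast
  then show ?thesis
    using assms by (intro exI[of _ "C \<union> {z \<in> carrier L. z \<sqsubseteq> x}"]) auto
next
  case False
  then show ?thesis
    using assms by (intro exI[of _ "C \<union> {z \<in> carrier L. z \<sqsubseteq> y}"]) auto
qed

lemma convex_geometry_clsys:
  assumes "default_enabled L"
  shows "convex_geometry (carrier L) (clsys L)"
  unfolding clsys_def[abs_def]
proof (rule convex_geometryI)
  fix C x y
  assume "closure_system L C" "x \<in> carrier L - C" "y \<in> carrier L - C" "x \<noteq> y"
  then show "\<exists>K. closure_system L K \<and> C \<subseteq> K \<and> (y \<in> K \<and> x \<notin> K \<or> x \<in> K \<and> y \<notin> K)"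
    by (intro down_separates closure_system_Un_down)
qed (use closure_system_iff closure_system_Inter assms in blast)+

lemma convex_geometry_dcclsys:
  assumes "default_enabled L"
  shows "convex_geometry (carrier L) (dcclsys L)"
proof -
  let ?Q = "\<lambda>C. closure_system L C \<and> closed_directed_joins L C"
  have "convex_geometry (carrier L)
    (\<lambda>X. THE C. least (powerset_lattice (carrier L)) C {C. ?Q C \<and> X \<subseteq> C})"
  proof (rule convex_geometryI)
    fix C x y
    assume "?Q C" "x \<in> carrier L - C" "y \<in> carrier L - C" "x \<noteq> y"
    then show "\<exists>K. ?Q K \<and> C \<subseteq> K \<and> (y \<in> K \<and> x \<notin> K \<or> x \<in> K \<and> y \<notin> K)"
      by (intro down_separates conjI closure_system_Un_down closed_directed_joins_Un_down) auto
  next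
    fix F assume "\<And>C. C \<in> F \<Longrightarrow> ?Q C"
    then show "?Q (carrier L \<inter> \<Inter>F)"
      using assms by (intro conjI closure_system_Inter closed_directed_joins_Inter) auto
  qed (use closure_system_iff in blast)
  then show ?thesis
    \<comment> \<open>Only the bracketing of the three conjuncts differs from that in
      \<open>dcclsys_def\<close>.\<close>
    unfolding dcclsys_def[abs_def] by (simp add: conj_assoc)
qed

end

theorem proposition9p7:
  fixes P :: "('a, 'b) gorder_scheme"
  assumes "partial_order P"
    and "default_enabled P"
  shows "convex_geometry (carrier P) (clsys P) \<and> convex_geometry (carrier P) (dcclsys P)"
  using assms partial_order.convex_geometry_clsys partial_order.convex_geometry_dcclsys by blast

end
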